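(* Let $k\ge 1$ be an integer and suppose there are constants $C_{rs},C_{svd}>0$ such that $C_{rs}^{-1}k\le\#\hat t\le C_{rs}k$ for all leaves $t$ of the cluster tree $\mathcal{T}_{\mathcal I}$, and such that the singular value decomposition of an $n$-by-$m$ matrix can be computed in not more than $C_{svd}\min\{n^2,m^2\}\max\{n,m\}$ operations. Then, applied to any matrix $G\in\mathbb{C}^{\mathcal I\times\mathcal I}$, the compression algorithm described in the context requires not more than $$C_{ba}\,k^2\,(\#\mathcal{T}_{\mathcal I})\,(\#\mathcal I)\ \text{ operations},\qquad C_{ba}:=\max\{C_{svd}C_{rs}^2+2C_{rs},\ 4C_{svd}+4\}.$$ If, in addition, there is a constant $C_{sn}\ge1$ such that $\#\operatorname{sons}(t)\le C_{sn}$ and $\#\operatorname{sons}(t)\neq1$ for all $t\in\mathcal{T}_{\mathcal I}$, then the algorithm requires not more than $$C_{ba}\,C_{lv}\,k\,(\#\mathcal I)^2\ \text{ operations},$$ where $C_{lv}:=\max\{C_{bb}C_{ov},2C_{rs}\}$ with the positive constants $C_{bb},C_{ov}$ from the context.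
   Context: $\mathcal I$ is a finite nonempty index set. A cluster tree $\mathcal{T}_{\mathcal I}$ is a finite rooted tree whose nodes $t$ (clusters) carry labels $\hat t\subseteq\mathcal I$ such that the root has label $\mathcal I$, distinct sons of the same node have disjoint labels, and $\hat t=\bigcup_{t'\in\operatorname{sons}(t)}\hat t'$ if $\operatorname{sons}(t)\ne\emptyset$. Every non-leaf cluster $t$ has exactly two sons $t_1\ne t_2$. $\operatorname{level}(t)$ is the distance of $t$ from the root, $\operatorname{desc}(t)$ the set of descendants of $t$ including $t$. A block tree $\mathcal{T}_{\mathcal I\times\mathcal I}$ is a tree whose nodes (blocks) are pairs $b=(t,s)$ of clusters, labeled $\hat t\times\hat s$, whose root is (root, root), and in which every block $b=(t,s)$ with sons satisfies $\operatorname{sons}(b)=\operatorname{sons}(t)\times\operatorname{sons}(s)$. A subset $\mathcal{L}^+$ of its leaves (admissible leaves) is fixed. Directions: for each level $\ell$, $\mathcal{D}_\ell\subseteq\mathbb{R}^3$ is a finite set whose elements are unit vectors or $0$, and $\operatorname{sd}_\ell:\mathcal{D}_\ell\to\mathcal{D}_{\ell+1}$ satisfies $\|c-\operatorname{sd}_\ell(c)\|\le\|c-\tilde c\|$ for all $c\in\mathcal{D}_\ell,\tilde c\in\mathcal{D}_{\ell+1}$; $\mathcal{D}_t:=\mathcal{D}_{\operatorname{level}(t)}$, $\operatorname{sd}_t:=\operatorname{sd}_{\operatorname{level}(t)}$. Each $b=(t,s)\in\mathcal{L}^+$ is assigned a block direction $c_b\in\mathcal{D}_t=\mathcal{D}_s$.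 For $t\in\mathcal{T}_{\mathcal I}$, $c\in\mathcal{D}_t$, let $F_{tc}$ be the set of clusters $s$ for which there is a cluster $t^+$ with $t\in\operatorname{desc}(t^+)$, $b=(t^+,s)\in\mathcal{L}^+$ and $c=\operatorname{sd}_{\operatorname{level}(t)-1}\circ\cdots\circ\operatorname{sd}_{\operatorname{level}(t^+)}(c_b)$ (with $c=c_b$ if $t^+=t$). Let $\mathcal{F}_{tc}:=\bigcup\{\hat s:s\in F_{tc}\}$ and $G_{tc}:=G|_{\hat t\times\mathcal{F}_{tc}}$. Compression algorithm (constructs an orthogonal directional cluster basis $(Q_{tc})$ of rank $k$, recursively from the leaves to the root): - If $t$ is a leaf: for each $c\in\mathcal{D}_t$, compute the singular value decomposition of $G_{tc}$, let the columns of $Q_{tc}$ be the first $k$ left singular vectors (all of them if there are fewer than $k$), and compute $R_{tc}:=Q_{tc}^*G_{tc}$. - If $t$ has sons $t_1,t_2$: after treating the sons, for each $c\in\mathcal{D}_t$ set $c':=\operatorname{sd}_t(c)$, form $\widehat G_{tc}:=\begin{pmatrix} R_{t_1c'}|_{k\times\mathcal{F}_{tc}} \\ R_{t_2c'}|_{k\times\mathcal{F}_{tc}} \end{pmatrix}$ by copying (it has at most $2k$ rows), compute its singular value decomposition, let the columns of $\widehat Q_{tc}$ be the first $k$ left singular vectors (all of them if there are fewer than $k$), obtain the transfer matrices by splitting $\widehat Q_{tc}=\begin{pmatrix} E_{t_1c} \\ E_{t_2c} \end{pmatrix}$, and compute $R_{tc}:=\widehat Q_{tc}^*\widehat G_{tc}$.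 Cost model: the product of a $p\times q$ and a $q\times r$ matrix takes at most $2pqr$ operations, singular value decompositions cost as in the claim, copying entries costs nothing. $C_{bb},C_{ov}>0$ are positive real constants (they enter only through the definition of $C_{lv}$). *)

theory Defs
  imports "HOL-Analysis.Analysis" "Jordan_Normal_Form.Schur_Decomposition"
begin

section \<open>Rooted trees\<close>

record 'n rtree =
  nodes :: "'n set"
  root :: 'n
  sons :: "'n \<Rightarrow> 'n set"

definition arcs :: "('n, 'm) rtree_scheme \<Rightarrow> ('n \<times> 'n) set" where
  "arcs T = {(t, t'). t \<in> nodes T \<and> t' \<in> sons T t}"

definition rooted_tree :: "('n, 'm) rtree_scheme \<Rightarrow> bool" where
  "rooted_tree T \<longleftrightarrow>
     finite (nodes T) \<and> root T \<in> nodes T \<and>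
     (\<forall>t \<in> nodes T. sons T t \<subseteq> nodes T \<and> root T \<notin> sons T t) \<and>
     (\<forall>t \<in> nodes T. t \<noteq> root T \<longrightarrow> (\<exists>!p. p \<in> nodes T \<and> t \<in> sons T p)) \<and>
     (\<forall>t \<in> nodes T. (root T, t) \<in> (arcs T)\<^sup>*)"

definition leaves :: "('n, 'm) rtree_scheme \<Rightarrow> 'n set" where
  "leaves T = {t \<in> nodes T. sons T t = {}}"

definition desc :: "('n, 'm) rtree_scheme \<Rightarrow> 'n \<Rightarrow> 'n set" where
  "desc T t = {t' \<in> nodes T. (t, t') \<in> (arcs T)\<^sup>*}"

definition level :: "('n, 'm) rtree_scheme \<Rightarrow> 'n \<Rightarrow> nat" where
  "level T t = (LEAST n. (root T, t) \<in> arcs T ^^ n)"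

section \<open>Cluster trees, block trees and directions\<close>

record ('n, 'i) ctree = "'n rtree" +
  label :: "'n \<Rightarrow> 'i set"

definition cluster_tree :: "'i set \<Rightarrow> ('n, 'i) ctree \<Rightarrow> bool" where
  "cluster_tree I T \<longleftrightarrow>
     rooted_tree T \<and> label T (root T) = I \<and>
     (\<forall>t \<in> nodes T. label T t \<subseteq> I) \<and>
     (\<forall>t \<in> nodes T. \<forall>t\<^sub>1 \<in> sons T t. \<forall>t\<^sub>2 \<in> sons T t.
        t\<^sub>1 \<noteq> t\<^sub>2 \<longrightarrow> label T t\<^sub>1 \<inter> label T t\<^sub>2 = {}) \<and>
     (\<forall>t \<in> nodes T. sons T t \<noteq> {} \<longrightarrow> label T t = \<Union> (label T ` sons T t))"

definition block_tree :: "('n, 'i) ctree \<Rightarrow> ('n \<times> 'n) rtree \<Rightarrow> bool" where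
  "block_tree T B \<longleftrightarrow>
     rooted_tree B \<and> nodes B \<subseteq> nodes T \<times> nodes T \<and> root B = (root T, root T) \<and>
     (\<forall>(t, s) \<in> nodes B. sons B (t, s) \<noteq> {} \<longrightarrow> sons B (t, s) = sons T t \<times> sons T s)"

text \<open>Only the levels that occur in the tree are constrained.\<close>

definition direction_family ::
  "('n, 'm) rtree_scheme \<Rightarrow> (nat \<Rightarrow> (real ^ 3) set) \<Rightarrow> (nat \<Rightarrow> real ^ 3 \<Rightarrow> real ^ 3) \<Rightarrow> bool" where
  "direction_family T D sd \<longleftrightarrow>
     (\<forall>l \<in> level T ` nodes T. finite (D l) \<and> (\<forall>c \<in> D l. norm c = 1 \<or> c = 0)) \<and>
     (\<forall>l. l \<in> level T ` nodes T \<and> Suc l \<in> level T ` nodes T \<longrightarrow>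
        sd l \<in> D l \<rightarrow> D (Suc l) \<and>
        (\<forall>c \<in> D l. \<forall>c' \<in> D (Suc l). norm (c - sd l c) \<le> norm (c - c')))"

text \<open>
  The functions \<open>son1\<close> and \<open>son2\<close> number the two sons of a non-leaf cluster. They are arbitrary
  on leaves.
\<close>

locale directional_clusters =
  fixes I :: "'i set"
    and T :: "('n, 'i) ctree"
    and son1 son2 :: "'n \<Rightarrow> 'n"
    and B :: "('n \<times> 'n) rtree"
    and adm :: "('n \<times> 'n) set"
    and D :: "nat \<Rightarrow> (real ^ 3) set"
    and sd :: "nat \<Rightarrow> real ^ 3 \<Rightarrow> real ^ 3"
    and bdir :: "'n \<times> 'n \<Rightarrow> real ^ 3"
  assumes index_set: "finite I" "I \<noteq> {}"
    and clusters: "cluster_tree I T"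
    and two_sons: "\<And>t. t \<in> nodes T \<Longrightarrow> sons T t \<noteq> {} \<Longrightarrow> sons T t = {son1 t, son2 t} \<and> son1 t \<noteq> son2 t"
    and blocks: "block_tree T B"
    and admissible: "adm \<subseteq> leaves B"
    and directions: "direction_family T D sd"
    and block_directions: "\<And>t s. (t, s) \<in> adm \<Longrightarrow> bdir (t, s) \<in> D (level T t)"
begin

text \<open>
  The term \<^term>\<open>fold sd [a..<b] c\<close> applies \<open>sd a\<close> first and \<open>sd (b - 1)\<close> last.
\<close>

definition far_clusters :: "'n \<Rightarrow> real ^ 3 \<Rightarrow> 'n set" where
  "far_clusters t c = {s. \<exists>u \<in> nodes T. t \<in> desc T u \<and> (u, s) \<in> adm \<and>
     c = fold sd [level T u..<level T t] (bdir (u, s))}"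

definition far_field :: "'n \<Rightarrow> real ^ 3 \<Rightarrow> 'i set" where
  "far_field t c = \<Union> (label T ` far_clusters t c)"

end

section \<open>Matrices with rows and columns labelled by index sets\<close>

text \<open>
  Library matrices are indexed by initial segments of the natural numbers. A matrix whose rows or
  columns belong to a finite set \<open>X\<close> is stored in the order of a fixed enumeration of \<open>X\<close>.
\<close>

definition listing :: "'a set \<Rightarrow> 'a list" where
  "listing X = (SOME xs. distinct xs \<and> set xs = X)"

definition position :: "'a set \<Rightarrow> 'a \<Rightarrow> nat" where
  "position X x = (THE j. j < card X \<and> listing X ! j = x)"

definition sub_block :: "('i \<Rightarrow> 'i \<Rightarrow> complex) \<Rightarrow> 'i set \<Rightarrow> 'i set \<Rightarrow> complex mat" where
  "sub_block G X Y = Matrix.mat (card X) (card Y) (\<lambda>(i, j). G (listing X ! i) (listing Y ! j))"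

text \<open>The columns of \<open>A\<close> are labelled by \<open>X\<close>, and those labelled by \<open>Y \<subseteq> X\<close> are kept.\<close>

definition restrict_cols :: "complex mat \<Rightarrow> 'i set \<Rightarrow> 'i set \<Rightarrow> complex mat" where
  "restrict_cols A X Y =
     Matrix.mat (dim_row A) (card Y) (\<lambda>(i, j). A $$ (i, position X (listing Y ! j)))"

definition first_cols :: "nat \<Rightarrow> complex mat \<Rightarrow> complex mat" where
  "first_cols k A = mat_of_cols (dim_row A) (take k (cols A))"

definition first_rows :: "nat \<Rightarrow> complex mat \<Rightarrow> complex mat" where
  "first_rows r A = mat_of_rows (dim_col A) (take r (Matrix.rows A))"

definition drop_rows :: "nat \<Rightarrow> complex mat \<Rightarrow> complex mat" where
  "drop_rows r A = mat_of_rows (dim_col A) (drop r (Matrix.rows A))"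

section \<open>Matrix arithmetic with operation counts\<close>

text \<open>
  The decomposition is the reduced one: an \<open>n \<times> m\<close> matrix has \<open>min n m\<close> left singular vectors.
\<close>

definition is_svd :: "complex mat \<Rightarrow> complex mat \<Rightarrow> real list \<Rightarrow> complex mat \<Rightarrow> bool" where
  "is_svd A U \<sigma> V \<longleftrightarrow>
     (let p = min (dim_row A) (dim_col A) in
        U \<in> carrier_mat (dim_row A) p \<and> V \<in> carrier_mat (dim_col A) p \<and>
        mat_adjoint U * U = 1\<^sub>m p \<and> mat_adjoint V * V = 1\<^sub>m p \<and>
        length \<sigma> = p \<and> sorted_wrt (\<ge>) \<sigma> \<and> (\<forall>x \<in> set \<sigma>. 0 \<le> x) \<and>
        A = U * mat_diag p (\<lambda>i. complex_of_real (\<sigma> ! i)) * mat_adjoint V)"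

text \<open>
  Procedures return their result together with the number of operations they have spent.
\<close>

type_synonym svd_proc = "complex mat \<Rightarrow> (complex mat \<times> real list \<times> complex mat) \<times> nat"
type_synonym mul_proc = "complex mat \<Rightarrow> complex mat \<Rightarrow> complex mat \<times> nat"

definition svd_within :: "real \<Rightarrow> svd_proc \<Rightarrow> bool" where
  "svd_within C svd \<longleftrightarrow>
     (\<forall>A. case svd A of ((U, \<sigma>, V), w) \<Rightarrow>
        is_svd A U \<sigma> V \<and>
        real w \<le> C * real (min ((dim_row A)\<^sup>2) ((dim_col A)\<^sup>2)) * real (max (dim_row A) (dim_col A)))"

definition standard_mul :: "mul_proc \<Rightarrow> bool" where
  "standard_mul mul \<longleftrightarrow>
     (\<forall>A B. dim_col A = dim_row B \<longrightarrow>
        (case mul A B of (P, w) \<Rightarrow> P = A * B \<and> w \<le> 2 * dim_row A * dim_col A * dim_col B))"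

text \<open>
  The truncation step common to leaves and non-leaf clusters: \<open>Q\<close> consists of the first \<open>k\<close> left
  singular vectors of \<open>A\<close>, and \<open>R = Q\<^sup>* A\<close>. Like any copying of entries, forming the adjoint is not counted.
\<close>

definition truncated_svd ::
  "svd_proc \<Rightarrow> mul_proc \<Rightarrow> nat \<Rightarrow> complex mat \<Rightarrow> complex mat \<times> complex mat \<times> nat" where
  "truncated_svd svd mul k A =
     (let ((U, \<sigma>, V), w\<^sub>1) = svd A;
          Q = first_cols k U;
          (R, w\<^sub>2) = mul (mat_adjoint Q) A
      in (Q, R, w\<^sub>1 + w\<^sub>2))"

section \<open>The compression algorithm\<close>

text \<open>
  The entry \<open>transfer (t', c)\<close> is the matrix \<open>E\<close> of the son \<open>t'\<close>, for a direction \<open>c\<close> of its father;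
  \<open>weight (t, c)\<close> is the matrix \<open>R\<close> of \<open>t\<close> and \<open>c\<close>.
\<close>

record 'n comp_state =
  leaf_basis :: "'n \<times> (real ^ 3) \<Rightarrow> complex mat"
  transfer :: "'n \<times> (real ^ 3) \<Rightarrow> complex mat"
  weight :: "'n \<times> (real ^ 3) \<Rightarrow> complex mat"
  ops :: nat

definition initial_state :: "'n comp_state" where
  "initial_state = \<lparr>leaf_basis = (\<lambda>_. 0\<^sub>m 0 0), transfer = (\<lambda>_. 0\<^sub>m 0 0), weight = (\<lambda>_. 0\<^sub>m 0 0), ops = 0\<rparr>"

context directional_clusters
begin

definition treat_leaf ::
  "svd_proc \<Rightarrow> mul_proc \<Rightarrow> nat \<Rightarrow> ('i \<Rightarrow> 'i \<Rightarrow> complex) \<Rightarrow> 'n \<Rightarrow> real ^ 3 \<Rightarrow>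
   'n comp_state \<Rightarrow> 'n comp_state" where
  "treat_leaf svd mul k G t c \<sigma> =
     (let (Q, R, w) = truncated_svd svd mul k (sub_block G (label T t) (far_field t c))
      in \<sigma>\<lparr>leaf_basis := (leaf_basis \<sigma>)((t, c) := Q),
           weight := (weight \<sigma>)((t, c) := R),
           ops := ops \<sigma> + w\<rparr>)"

definition treat_inner ::
  "svd_proc \<Rightarrow> mul_proc \<Rightarrow> nat \<Rightarrow> 'n \<Rightarrow> real ^ 3 \<Rightarrow> 'n comp_state \<Rightarrow> 'n comp_state" where
  "treat_inner svd mul k t c \<sigma> =
     (let t\<^sub>1 = son1 t; t\<^sub>2 = son2 t; c' = sd (level T t) c;
          R\<^sub>1 = weight \<sigma> (t\<^sub>1, c'); R\<^sub>2 = weight \<sigma> (t\<^sub>2, c');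
          A = restrict_cols R\<^sub>1 (far_field t\<^sub>1 c') (far_field t c) @\<^sub>r
              restrict_cols R\<^sub>2 (far_field t\<^sub>2 c') (far_field t c);
          (Q, R, w) = truncated_svd svd mul k A
      in \<sigma>\<lparr>transfer := (transfer \<sigma>)((t\<^sub>1, c) := first_rows (dim_row R\<^sub>1) Q,
                                    (t\<^sub>2, c) := drop_rows (dim_row R\<^sub>1) Q),
           weight := (weight \<sigma>)((t, c) := R),
           ops := ops \<sigma> + w\<rparr>)"

lemma tree: "rooted_tree T"
  using clusters by (simp add: cluster_tree_def)

lemma path_length_unique:
  "(root T, t) \<in> arcs T ^^ m \<Longrightarrow> (root T, t) \<in> arcs T ^^ n \<Longrightarrow> m = n"
proof (induction m arbitrary: t n)
  case 0
  then have "t = root T" by simp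
  show ?case
  proof (cases n)
    case (Suc n')
    then obtain p where "(p, root T) \<in> arcs T"
      using 0 \<open>t = root T\<close> by auto
    then show ?thesis using tree by (auto simp: arcs_def rooted_tree_def)
  qed simp
next
  case (Suc m)
  obtain p where p: "(root T, p) \<in> arcs T ^^ m" "(p, t) \<in> arcs T"
    using Suc.prems(1) by auto
  then have t: "t \<in> nodes T" "t \<noteq> root T"
    using tree by (auto simp: arcs_def rooted_tree_def)
  show ?case
  proof (cases n)
    case 0
    then show ?thesis using Suc.prems t by simp
  next
    case (Suc n')
    then obtain q where q: "(root T, q) \<in> arcs T ^^ n'" "(q, t) \<in> arcs T"
      using Suc.prems(2) by auto
    have "p = q"
      using tree t p(2) q(2) by (auto simp: arcs_def rooted_tree_def)
    then show ?thesis using Suc.IH[OF p(1)] q(1) Suc by simp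
  qed
qed

lemma level_eq: "(root T, t) \<in> arcs T ^^ n \<Longrightarrow> level T t = n"
  unfolding level_def by (rule Least_equality) (use path_length_unique in auto)

lemma level_son:
  assumes "t \<in> nodes T" "t' \<in> sons T t"
  shows "level T t' = Suc (level T t)"
proof -
  obtain n where n: "(root T, t) \<in> arcs T ^^ n"
    using tree assms(1) by (auto simp: rooted_tree_def rtrancl_power)
  then have "(root T, t') \<in> arcs T ^^ Suc n"
    using assms by (auto simp: arcs_def)
  then show ?thesis using n level_eq by metis
qed

text \<open>
  The test \<open>t \<notin> nodes T\<close> only makes the recursion total; it never succeeds in a call from the root.
\<close>

function compress ::
  "svd_proc \<Rightarrow> mul_proc \<Rightarrow> nat \<Rightarrow> ('i \<Rightarrow> 'i \<Rightarrow> complex) \<Rightarrow> 'n \<Rightarrow> 'n comp_state \<Rightarrow> 'n comp_state" where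
  "compress svd mul k G t \<sigma> =
     (if t \<notin> nodes T then \<sigma>
      else if sons T t = {} then
        fold (treat_leaf svd mul k G t) (listing (D (level T t))) \<sigma>
      else
        let \<sigma>\<^sub>1 = compress svd mul k G (son1 t) \<sigma>;
            \<sigma>\<^sub>2 = compress svd mul k G (son2 t) \<sigma>\<^sub>1
        in fold (treat_inner svd mul k t) (listing (D (level T t))) \<sigma>\<^sub>2)"
  by pat_completeness auto
termination
proof -
  let ?f = "\<lambda>t. if t \<in> nodes T then Suc (Max (level T ` nodes T) - level T t) else 0"
  have less: "?f t' < ?f t" if "t \<in> nodes T" "t' \<in> sons T t" for t t'
  proof -
    have "t' \<in> nodes T" "finite (nodes T)"
      using tree that by (auto simp: rooted_tree_def)
    then have "level T t' \<le> Max (level T ` nodes T)" by simp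
    then show ?thesis using level_son[OF that] that by auto
  qed
  have sons: "son1 t \<in> sons T t" "son2 t \<in> sons T t" if "t \<in> nodes T" "sons T t \<noteq> {}" for t
    using two_sons[OF that] by blast+
  show ?thesis
    by (relation "Wellfounded.measure (\<lambda>(svd, mul, k, G, t, \<sigma>). ?f t)")
      (use less sons in \<open>simp_all del: if_split\<close>)
qed

declare compress.simps [simp del]

definition compression_ops :: "svd_proc \<Rightarrow> mul_proc \<Rightarrow> nat \<Rightarrow> ('i \<Rightarrow> 'i \<Rightarrow> complex) \<Rightarrow> nat" where
  "compression_ops svd mul k G = ops (compress svd mul k G (root T) initial_state)"

end

end

theory Submission
  imports Defs
begin

text \<open>
  One step of the algorithm, for a cluster \<open>t\<close> and a direction \<open>c\<close>, decomposes a matrix \<open>A\<close> with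
  \<open>m = card (far_field t c)\<close> columns and multiplies it by at most \<open>k\<close> rows. If \<open>A\<close> has \<open>n \<le> r k\<close>
  rows, the decomposition costs at most \<open>C\<^sub>s\<^sub>v\<^sub>d n\<^sup>2 m\<close> and the product at most \<open>2 k n m\<close> operations,
  together at most \<open>(C\<^sub>s\<^sub>v\<^sub>d r\<^sup>2 + 2 r) k\<^sup>2 m\<close> (\<open>truncated_svd_cost\<close>). On a leaf \<open>r = C\<^sub>r\<^sub>s\<close>. On an inner
  cluster \<open>A\<close> is stacked from two weight matrices, each with at most \<open>k\<close> rows, so \<open>r = 2\<close>. These
  are the two terms in the maximum \<open>C\<^sub>b\<^sub>a\<close>.

  There may be many directions, but their number does not multiply the cost of a cluster \<open>t\<close>, since
  the far fields of \<open>t\<close> for different directions are disjoint (\<open>far_field_disjoint\<close>): an index \<open>x\<close>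
  and a cluster \<open>t\<close> determine at most one admissible block \<open>(u, s)\<close> such that \<open>u\<close> is an ancestor of
  \<open>t\<close> and \<open>x\<close> lies in the label of \<open>s\<close>, because the blocks \<open>(u, s)\<close> with these two properties lie on
  one path of the block tree and admissible blocks are leaves. The block determines the direction.
  Hence the column numbers \<open>m\<close> for one cluster sum up to at most \<open>card I\<close>, and each cluster costs at
  most \<open>C\<^sub>b\<^sub>a k\<^sup>2 card I\<close>. This is the first bound.

  For the second bound, the clusters are counted. The leaf labels partition \<open>I\<close> into pieces of size
  at least \<open>k / C\<^sub>r\<^sub>s\<close>, so there are at most \<open>C\<^sub>r\<^sub>s card I / k\<close> leaves, and a binary tree has fewer than
  twice as many nodes as leaves (\<open>card_desc_bound\<close>). Thus \<open>k\<close> times the number of clusters is at most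
  \<open>2 C\<^sub>r\<^sub>s card I \<le> C\<^sub>l\<^sub>v card I\<close>.
\<close>

section \<open>Ancestors in a cluster tree\<close>

context directional_clusters
begin

lemma son_in_nodes: "t \<in> nodes T \<Longrightarrow> t' \<in> sons T t \<Longrightarrow> t' \<in> nodes T"
  using tree by (auto simp: rooted_tree_def)

lemma finite_nodes: "finite (nodes T)"
  using tree by (simp add: rooted_tree_def)

lemma path_to_node: "t \<in> nodes T \<Longrightarrow> (root T, t) \<in> arcs T ^^ level T t"
  using tree level_eq by (metis rooted_tree_def rtrancl_power)

lemma level_path:
  assumes "t \<in> nodes T" "(t, t') \<in> arcs T ^^ n"
  shows "level T t' = level T t + n"
proof -
  have "(root T, t') \<in> arcs T ^^ (level T t + n)"
    using path_to_node[OF assms(1)] assms(2) by (auto simp: relpow_add)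
  then show ?thesis by (rule level_eq)
qed

lemma path_in_nodes:
  assumes "t \<in> nodes T" "(t, t') \<in> (arcs T)\<^sup>*"
  shows "t' \<in> nodes T"
  using assms(2,1) by induction (auto simp: arcs_def son_in_nodes)

lemma unique_father:
  "p \<in> nodes T \<Longrightarrow> q \<in> nodes T \<Longrightarrow> t \<in> sons T p \<Longrightarrow> t \<in> sons T q \<Longrightarrow> p = q"
  using tree son_in_nodes unfolding rooted_tree_def by metis

lemma unique_ancestor:
  assumes "u \<in> nodes T" "v \<in> nodes T" "(u, t) \<in> (arcs T)\<^sup>*" "(v, t) \<in> (arcs T)\<^sup>*"
    and "level T u = level T v"
  shows "u = v"
proof -
  obtain n where n: "(u, t) \<in> arcs T ^^ n" using assms(3) rtrancl_power by blast
  obtain m where m: "(v, t) \<in> arcs T ^^ m" using assms(4) rtrancl_power by blast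
  have "m = n"
    using level_path[OF assms(1) n] level_path[OF assms(2) m] assms(5) by simp
  have "(u, t) \<in> arcs T ^^ n \<Longrightarrow> (v, t) \<in> arcs T ^^ n \<Longrightarrow> u = v"
  proof (induction n arbitrary: t)
    case (Suc n)
    then obtain p q where "(u, p) \<in> arcs T ^^ n" "(p, t) \<in> arcs T"
      "(v, q) \<in> arcs T ^^ n" "(q, t) \<in> arcs T" by auto
    moreover from this have "p = q" using unique_father by (auto simp: arcs_def)
    ultimately show ?case using Suc.IH by blast
  qed simp
  then show ?thesis using n m \<open>m = n\<close> by simp
qed

lemma label_of_ancestor:
  assumes "(t, t') \<in> (arcs T)\<^sup>*"
  shows "label T t' \<subseteq> label T t"
  using assms
proof induction
  case (step p q)
  then have "p \<in> nodes T" "q \<in> sons T p" by (auto simp: arcs_def)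
  moreover have "\<forall>t \<in> nodes T. sons T t \<noteq> {} \<longrightarrow> label T t = \<Union> (label T ` sons T t)"
    using clusters by (simp add: cluster_tree_def)
  ultimately have "label T q \<subseteq> label T p" by blast
  then show ?case using step by simp
qed simp

text \<open>
  The clusters of one level have disjoint labels, even if they are not brothers: their fathers also
  contain \<open>x\<close>, so by induction on the level they are brothers after all.
\<close>

lemma unique_cluster_of_index:
  assumes "s \<in> nodes T" "s' \<in> nodes T" "level T s = level T s'"
    and "x \<in> label T s" "x \<in> label T s'"
  shows "s = s'"
proof -
  have "(root T, s) \<in> arcs T ^^ n \<Longrightarrow> (root T, s') \<in> arcs T ^^ n \<Longrightarrow>
      x \<in> label T s \<Longrightarrow> x \<in> label T s' \<Longrightarrow> s = s'" for n
  proof (induction n arbitrary: s s')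
    case (Suc n)
    then obtain p q where p: "(root T, p) \<in> arcs T ^^ n" "(p, s) \<in> arcs T"
      and q: "(root T, q) \<in> arcs T ^^ n" "(q, s') \<in> arcs T" by auto
    then have nodes: "p \<in> nodes T" "q \<in> nodes T" "s \<in> sons T p" "s' \<in> sons T q"
      by (auto simp: arcs_def)
    have "x \<in> label T p" "x \<in> label T q"
      using label_of_ancestor[of p s] label_of_ancestor[of q s'] p q nodes Suc.prems by auto
    then have "p = q" using Suc.IH p q by blast
    then show ?case
      using clusters nodes Suc.prems unfolding cluster_tree_def by blast
  qed simp
  then show ?thesis using assms path_to_node by metis
qed

section \<open>Admissible blocks and far fields\<close>

text \<open>
  The sons of a block are pairs of sons, so the two components of a block descend in step. In
  particular both clusters of a block have the level of the block.
\<close>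

lemma path_of_blocks:
  assumes "(b, b') \<in> arcs B ^^ n"
  shows "(fst b, fst b') \<in> arcs T ^^ n \<and> (snd b, snd b') \<in> arcs T ^^ n"
  using assms
proof (induction n arbitrary: b')
  case (Suc n)
  then obtain a where a: "(b, a) \<in> arcs B ^^ n" "(a, b') \<in> arcs B" by auto
  then have "a \<in> nodes B" "b' \<in> sons B a" by (auto simp: arcs_def)
  then have "fst a \<in> nodes T \<and> snd a \<in> nodes T \<and> b' \<in> sons T (fst a) \<times> sons T (snd a)"
    using blocks unfolding block_tree_def by fastforce
  then have "(fst a, fst b') \<in> arcs T" "(snd a, snd b') \<in> arcs T" by (auto simp: arcs_def)
  then show ?case using Suc.IH[OF a(1)] by auto
qed simp

lemma block_in_nodes: "(t, s) \<in> nodes B \<Longrightarrow> t \<in> nodes T \<and> s \<in> nodes T"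
  using blocks by (auto simp: block_tree_def)

lemma path_to_block:
  assumes "(t, s) \<in> nodes B"
  shows "((root T, root T), (t, s)) \<in> arcs B ^^ level T s" "level T t = level T s"
proof -
  obtain n where n: "((root T, root T), (t, s)) \<in> arcs B ^^ n"
    using blocks assms unfolding block_tree_def rooted_tree_def by (metis rtrancl_power)
  then have "level T t = n" "level T s = n"
    using path_of_blocks[OF n] level_eq by auto
  then show "((root T, root T), (t, s)) \<in> arcs B ^^ level T s" "level T t = level T s"
    using n by auto
qed

lemma admissible_in_leaves: "b \<in> adm \<Longrightarrow> b \<in> nodes B \<and> sons B b = {}"
  using admissible by (auto simp: leaves_def)

text \<open>
  The ancestor of \<open>(u', s')\<close> on the level of \<open>s\<close> is \<open>(u, s)\<close>: its first component is an ancestor of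
  \<open>t\<close> on the level of \<open>u\<close>, and its second component is a cluster containing \<open>x\<close> on the level of
  \<open>s\<close>. Both are unique. Since \<open>(u, s)\<close> is a leaf of the block tree, it is its own only descendant.
\<close>

lemma unique_admissible_block_aux:
  assumes adm: "(u, s) \<in> adm" "(u', s') \<in> adm"
    and desc: "t \<in> desc T u" "t \<in> desc T u'"
    and x: "x \<in> label T s" "x \<in> label T s'"
    and le: "level T s \<le> level T s'"
  shows "(u, s) = (u', s')"
proof -
  have b: "(u, s) \<in> nodes B" "(u', s') \<in> nodes B" "sons B (u, s) = {}"
    using adm admissible_in_leaves by auto
  note nodes = block_in_nodes[OF b(1)] block_in_nodes[OF b(2)]
  define m where "m = level T s' - level T s"
  have "((root T, root T), (u', s')) \<in> arcs B ^^ (level T s + m)"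
    using path_to_block[OF b(2)] le by (simp add: m_def)
  then obtain v w where vw: "((root T, root T), (v, w)) \<in> arcs B ^^ level T s"
      "((v, w), (u', s')) \<in> arcs B ^^ m"
    by (auto simp: relpow_add)
  have root: "root T \<in> nodes T" using tree by (simp add: rooted_tree_def)
  \<comment> \<open>\<open>(v, w)\<close> is the ancestor of \<open>(u', s')\<close> on the level of \<open>(u, s)\<close>.\<close>
  have v: "(root T, v) \<in> arcs T ^^ level T s" "(v, u') \<in> arcs T ^^ m"
    and w: "(root T, w) \<in> arcs T ^^ level T s" "(w, s') \<in> arcs T ^^ m"
    using path_of_blocks[OF vw(1)] path_of_blocks[OF vw(2)] by auto
  have vw_nodes: "v \<in> nodes T" "w \<in> nodes T"
    using v w path_in_nodes[OF root] by (meson relpow_imp_rtrancl)+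
  have "x \<in> label T w"
    using label_of_ancestor[of w s'] w(2) x relpow_imp_rtrancl by blast
  then have "w = s"
    using unique_cluster_of_index vw_nodes nodes x level_eq[OF w(1)] by blast
  moreover have "v = u"
  proof (rule unique_ancestor)
    show "(v, t) \<in> (arcs T)\<^sup>*"
      using relpow_imp_rtrancl[OF v(2)] desc(2) by (auto simp: desc_def)
    show "(u, t) \<in> (arcs T)\<^sup>*" using desc(1) by (simp add: desc_def)
    show "level T v = level T u" using level_eq[OF v(1)] path_to_block(2)[OF b(1)] by simp
  qed (use vw_nodes nodes in auto)
  ultimately have "((u, s), (u', s')) \<in> (arcs B)\<^sup>*" using vw(2) relpow_imp_rtrancl by blast
  then show ?thesis
    by (rule converse_rtranclE) (use b(3) in \<open>auto simp: arcs_def\<close>)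
qed

lemma unique_admissible_block:
  assumes "(u, s) \<in> adm" "(u', s') \<in> adm" "t \<in> desc T u" "t \<in> desc T u'"
    and "x \<in> label T s" "x \<in> label T s'"
  shows "(u, s) = (u', s')"
proof (cases "level T s \<le> level T s'")
  case True
  with assms show ?thesis by (rule unique_admissible_block_aux)
next
  case False
  then have "level T s' \<le> level T s" by simp
  with assms(2,1,4,3,6,5) show ?thesis by (rule unique_admissible_block_aux[symmetric])
qed

lemma far_field_disjoint:
  assumes "c \<noteq> c'"
  shows "far_field t c \<inter> far_field t c' = {}"
proof (rule ccontr)
  assume "far_field t c \<inter> far_field t c' \<noteq> {}"
  then obtain x s s' where "s \<in> far_clusters t c" "s' \<in> far_clusters t c'"
    and x: "x \<in> label T s" "x \<in> label T s'"
    by (auto simp: far_field_def)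
  then obtain u u' where u: "t \<in> desc T u" "(u, s) \<in> adm"
      "c = fold sd [level T u..<level T t] (bdir (u, s))"
    and u': "t \<in> desc T u'" "(u', s') \<in> adm"
      "c' = fold sd [level T u'..<level T t] (bdir (u', s'))"
    by (auto simp: far_clusters_def)
  have "(u, s) = (u', s')"
    using unique_admissible_block u u' x by blast
  then show False using u(3) u'(3) assms by auto
qed

lemma label_subset: "t \<in> nodes T \<Longrightarrow> label T t \<subseteq> I"
  using clusters by (auto simp: cluster_tree_def)

lemma far_field_subset: "far_field t c \<subseteq> I"
proof
  fix x
  assume "x \<in> far_field t c"
  then obtain u s where "(u, s) \<in> adm" "x \<in> label T s"
    by (auto simp: far_field_def far_clusters_def)
  moreover from this have "s \<in> nodes T" using admissible_in_leaves block_in_nodes by blast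
  ultimately show "x \<in> I" using label_subset by blast
qed

text \<open>
  This makes the cost of one cluster independent of the number of directions.
\<close>

lemma sum_card_far_field:
  assumes "finite C"
  shows "(\<Sum>c\<in>C. card (far_field t c)) \<le> card I"
proof -
  have "(\<Sum>c\<in>C. card (far_field t c)) = card (\<Union>c\<in>C. far_field t c)"
    using assms far_field_disjoint finite_subset[OF far_field_subset index_set(1)]
    by (intro card_UN_disjoint[symmetric]) auto
  also have "\<dots> \<le> card I"
    using far_field_subset index_set(1) by (intro card_mono) auto
  finally show ?thesis .
qed

section \<open>Counting clusters\<close>

lemma desc_root: "desc T (root T) = nodes T"
  using tree by (auto simp: desc_def rooted_tree_def)

lemma desc_leaf:
  assumes "t \<in> nodes T" "sons T t = {}"
  shows "desc T t = {t}"
  using assms by (auto simp: desc_def arcs_def elim: converse_rtranclE)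

lemma sons_of_inner:
  assumes "t \<in> nodes T" "sons T t \<noteq> {}"
  shows "son1 t \<in> sons T t" "son2 t \<in> sons T t" "son1 t \<noteq> son2 t"
    "son1 t \<in> nodes T" "son2 t \<in> nodes T"
  using two_sons[OF assms] son_in_nodes[OF assms(1)] by auto

lemma card_desc_inner:
  assumes t: "t \<in> nodes T" "sons T t \<noteq> {}"
  shows "card (desc T t) = Suc (card (desc T (son1 t)) + card (desc T (son2 t)))"
proof -
  note s = sons_of_inner[OF t]
  have arc: "(t, x) \<in> arcs T \<longleftrightarrow> x = son1 t \<or> x = son2 t" for x
    using two_sons[OF t] t(1) by (auto simp: arcs_def)
  have "desc T t = insert t (desc T (son1 t) \<union> desc T (son2 t))"
    using t(1) arc unfolding desc_def
    by (auto elim: converse_rtranclE intro: converse_rtrancl_into_rtrancl)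
  moreover have "desc T (son1 t) \<inter> desc T (son2 t) = {}"
  proof -
    have "level T (son1 t) = level T (son2 t)" using level_son s t(1) by simp
    then show ?thesis using unique_ancestor[OF s(4,5)] s(3) by (auto simp: desc_def)
  qed
  moreover have "t \<notin> desc T t'" if "t' \<in> sons T t" for t'
  proof
    assume "t \<in> desc T t'"
    then obtain n where "(t', t) \<in> arcs T ^^ n" by (auto simp: desc_def rtrancl_power)
    then have "level T t = level T t' + n" using level_path son_in_nodes[OF t(1) that] by blast
    then show False using level_son[OF t(1) that] by simp
  qed
  moreover have "finite (desc T u)" for u using finite_nodes by (simp add: desc_def)
  ultimately show ?thesis using s by (simp add: card_Un_disjoint)
qed

lemma card_label_inner:
  assumes t: "t \<in> nodes T" "sons T t \<noteq> {}"
  shows "card (label T t) = card (label T (son1 t)) + card (label T (son2 t))"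
proof -
  note s = sons_of_inner[OF t]
  have "label T t = label T (son1 t) \<union> label T (son2 t)"
    using clusters t two_sons[OF t] unfolding cluster_tree_def by fastforce
  moreover have "label T (son1 t) \<inter> label T (son2 t) = {}"
    using clusters t s unfolding cluster_tree_def by blast
  moreover have "finite (label T (son1 t))" "finite (label T (son2 t))"
    using label_subset s index_set(1) finite_subset by blast+
  ultimately show ?thesis by (simp add: card_Un_disjoint)
qed

lemma subtree_induct [consumes 1, case_names leaf inner]:
  assumes "t \<in> nodes T"
    and leaf: "\<And>t. t \<in> nodes T \<Longrightarrow> sons T t = {} \<Longrightarrow> P t"
    and inner: "\<And>t. t \<in> nodes T \<Longrightarrow> sons T t \<noteq> {} \<Longrightarrow> P (son1 t) \<Longrightarrow> P (son2 t) \<Longrightarrow> P t"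
  shows "P t"
  using assms(1)
proof (induction "card (desc T t)" arbitrary: t rule: less_induct)
  case less
  show ?case
  proof (cases "sons T t = {}")
    case False
    show ?thesis
      using inner[OF less.prems False] less.hyps sons_of_inner[OF less.prems False]
        card_desc_inner[OF less.prems False] by simp
  qed (use leaf less.prems in blast)
qed

text \<open>
  The summand 1 makes both sides additive over the two sons: if they have \<open>d\<^sub>1\<close> and \<open>d\<^sub>2\<close>
  descendants, then \<open>t\<close> has \<open>d\<^sub>1 + d\<^sub>2 + 1\<close>, and \<open>(d\<^sub>1 + d\<^sub>2 + 1) + 1 = (d\<^sub>1 + 1) + (d\<^sub>2 + 1)\<close>.
\<close>

lemma card_desc_bound:
  assumes "t \<in> nodes T"
    and "\<And>t. t \<in> leaves T \<Longrightarrow> real k \<le> C * real (card (label T t))"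
  shows "(real (card (desc T t)) + 1) * real k \<le> 2 * C * real (card (label T t))"
  using assms(1)
proof (induction rule: subtree_induct)
  case (leaf t)
  then show ?case using assms(2)[of t] desc_leaf by (simp add: leaves_def)
next
  case (inner t)
  then show ?case
    by (simp add: card_desc_inner card_label_inner algebra_simps)
qed

end

section \<open>Cost of one truncated decomposition\<close>

lemma dim_mat_adjoint [simp]:
  "dim_row (mat_adjoint A) = dim_col A" "dim_col (mat_adjoint A) = dim_row A"
  by (simp_all add: mat_adjoint_def)

lemma min_square_mult_max_le:
  fixes n m :: nat
  shows "min (n\<^sup>2) (m\<^sup>2) * max n m \<le> n\<^sup>2 * m"
proof (cases "n \<le> m")
  case True
  then show ?thesis by simp
next
  case False
  then have "min (n\<^sup>2) (m\<^sup>2) * max n m \<le> m * m * n"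
    by (simp add: power2_eq_square)
  also have "\<dots> \<le> n * n * m" using False by (simp add: mult.commute mult.left_commute)
  finally show ?thesis by (simp add: power2_eq_square)
qed

text \<open>
  The row bound \<open>r k\<close> serves leaves with \<open>r = C\<^sub>r\<^sub>s\<close> and inner clusters with \<open>r = 2\<close>. The result has
  at most \<open>k\<close> rows again, which is what the father of the cluster relies on.
\<close>

lemma truncated_svd_cost:
  assumes svd: "svd_within C svd" and mul: "standard_mul mul" and "C \<ge> 0"
    and rows: "real (dim_row A) \<le> r * real k"
    and result: "truncated_svd svd mul k A = (Q, R, w)"
  shows "dim_row R \<le> k"
    and "real w \<le> (C * r\<^sup>2 + 2 * r) * (real k)\<^sup>2 * real (dim_col A)"
proof -
  let ?n = "dim_row A" and ?m = "dim_col A"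
  obtain U \<sigma> V w1 where s: "svd A = ((U, \<sigma>, V), w1)" by (metis prod.exhaust)
  have U: "U \<in> carrier_mat ?n (min ?n ?m)"
    and w1: "real w1 \<le> C * real (min (?n\<^sup>2) (?m\<^sup>2)) * real (max ?n ?m)"
    using svd s unfolding svd_within_def is_svd_def Let_def
    by (force split: prod.splits dest: spec[of _ A])+
  let ?Q = "first_cols k U"
  have Q: "dim_row ?Q = ?n" "dim_col ?Q \<le> k"
    using U by (auto simp: first_cols_def)
  obtain P w2 where p: "mul (mat_adjoint ?Q) A = (P, w2)" by fastforce
  then have "P = mat_adjoint ?Q * A" and w2: "w2 \<le> 2 * dim_col ?Q * ?n * ?m"
    using mul Q unfolding standard_mul_def by (force dest: spec[of _ "mat_adjoint ?Q"])+
  have R: "R = P" "w = w1 + w2"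
    using result s p by (auto simp: truncated_svd_def)
  show "dim_row R \<le> k" using Q by (simp add: R \<open>P = _\<close>)
  have "real w1 \<le> C * real (min (?n\<^sup>2) (?m\<^sup>2) * max ?n ?m)"
    using w1 by (simp only: of_nat_mult mult.assoc)
  also have "\<dots> \<le> C * real (?n\<^sup>2 * ?m)"
    using min_square_mult_max_le \<open>C \<ge> 0\<close> by (intro mult_left_mono of_nat_mono)
  also have "\<dots> = C * ((real ?n)\<^sup>2 * real ?m)" by simp
  also have "\<dots> \<le> C * ((r * real k)\<^sup>2 * real ?m)"
    using rows \<open>C \<ge> 0\<close> by (intro mult_left_mono mult_right_mono power_mono) auto
  finally have 1: "real w1 \<le> C * ((r * real k)\<^sup>2 * real ?m)" .
  have "real w2 \<le> real (2 * dim_col ?Q * ?n * ?m)" using w2 by (rule of_nat_mono)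
  also have "\<dots> = 2 * real (dim_col ?Q) * real ?n * real ?m" by simp
  also have "\<dots> \<le> 2 * real k * (r * real k) * real ?m"
    using rows Q(2) by (intro mult_right_mono mult_mono) auto
  finally show "real w \<le> (C * r\<^sup>2 + 2 * r) * (real k)\<^sup>2 * real ?m"
    using 1 by (simp add: R algebra_simps power2_eq_square)
qed

section \<open>Cost of the whole algorithm\<close>

lemma listing_finite:
  assumes "finite X"
  shows "distinct (listing X)" "set (listing X) = X"
proof -
  have "\<exists>xs. distinct xs \<and> set xs = X" using finite_distinct_list[OF assms] by blast
  from someI_ex[OF this] show "distinct (listing X)" "set (listing X) = X"
    by (simp_all add: listing_def)
qed

lemma fold_cost:
  fixes cost :: "'s \<Rightarrow> nat" and g :: "'c \<Rightarrow> real"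
  assumes "\<And>c s. c \<in> set cs \<Longrightarrow> Inv s \<Longrightarrow> Inv (f c s) \<and> real (cost (f c s)) \<le> real (cost s) + g c"
    and "Inv s"
  shows "Inv (fold f cs s) \<and> real (cost (fold f cs s)) \<le> real (cost s) + sum_list (map g cs)"
  using assms
proof (induction cs arbitrary: s)
  case (Cons c cs)
  have "Inv (f c s)" "real (cost (f c s)) \<le> real (cost s) + g c"
    using Cons.prems by auto
  then show ?case using Cons.IH[of "f c s"] Cons.prems(1) by fastforce
qed simp

context directional_clusters
begin

text \<open>
  The bound is required of all entries, including those that have not been computed yet; their
  default is the empty matrix. So it is an invariant of every single step, and it need not be
  tracked which weights the sons have already provided.
\<close>

definition weights_within :: "nat \<Rightarrow> 'n comp_state \<Rightarrow> bool" where
  "weights_within k \<sigma> \<longleftrightarrow> (\<forall>p. dim_row (weight \<sigma> p) \<le> k)"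

context
  fixes svd :: svd_proc and mul :: mul_proc and k :: nat and G :: "'i \<Rightarrow> 'i \<Rightarrow> complex"
    and Crs Csvd K :: real
  assumes Csvd: "Csvd > 0"
    and small: "\<And>t. t \<in> leaves T \<Longrightarrow> real (card (label T t)) \<le> Crs * real k"
    and svd: "svd_within Csvd svd" and mul: "standard_mul mul"
    and K1: "Csvd * Crs\<^sup>2 + 2 * Crs \<le> K" and K2: "4 * Csvd + 4 \<le> K"
begin

lemma treat_leaf_cost:
  assumes "t \<in> leaves T" "weights_within k \<sigma>"
  shows "weights_within k (treat_leaf svd mul k G t c \<sigma>) \<and>
    real (ops (treat_leaf svd mul k G t c \<sigma>)) \<le> real (ops \<sigma>) + K * (real k)\<^sup>2 * real (card (far_field t c))"
proof -
  let ?A = "sub_block G (label T t) (far_field t c)"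
  obtain Q R w where r: "truncated_svd svd mul k ?A = (Q, R, w)" by (metis prod.exhaust)
  have "real (dim_row ?A) \<le> Crs * real k" using small assms(1) by (simp add: sub_block_def)
  note b = truncated_svd_cost[OF svd mul less_imp_le[OF Csvd] this r]
  have "real w \<le> (Csvd * Crs\<^sup>2 + 2 * Crs) * (real k)\<^sup>2 * real (card (far_field t c))"
    using b(2) by (simp add: sub_block_def)
  also have "\<dots> \<le> K * (real k)\<^sup>2 * real (card (far_field t c))"
    using K1 by (intro mult_right_mono) auto
  finally show ?thesis
    using b(1) assms(2) by (auto simp: treat_leaf_def r weights_within_def)
qed

lemma treat_inner_cost:
  assumes "weights_within k \<sigma>"
  shows "weights_within k (treat_inner svd mul k t c \<sigma>) \<and>
    real (ops (treat_inner svd mul k t c \<sigma>)) \<le> real (ops \<sigma>) + K * (real k)\<^sup>2 * real (card (far_field t c))"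
proof -
  let ?c = "sd (level T t) c"
  let ?R1 = "weight \<sigma> (son1 t, ?c)" and ?R2 = "weight \<sigma> (son2 t, ?c)"
  let ?A = "restrict_cols ?R1 (far_field (son1 t) ?c) (far_field t c) @\<^sub>r
    restrict_cols ?R2 (far_field (son2 t) ?c) (far_field t c)"
  obtain Q R w where r: "truncated_svd svd mul k ?A = (Q, R, w)" by (metis prod.exhaust)
  have dims: "dim_row ?A = dim_row ?R1 + dim_row ?R2" "dim_col ?A = card (far_field t c)"
    by (simp_all add: append_rows_def restrict_cols_def)
  have "dim_row ?R1 \<le> k" "dim_row ?R2 \<le> k" using assms by (auto simp: weights_within_def)
  then have "real (dim_row ?A) \<le> 2 * real k" using dims by simp
  note b = truncated_svd_cost[OF svd mul less_imp_le[OF Csvd] this r]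
  have "real w \<le> (4 * Csvd + 4) * (real k)\<^sup>2 * real (card (far_field t c))"
    using b(2) by (simp add: dims mult.commute)
  also have "\<dots> \<le> K * (real k)\<^sup>2 * real (card (far_field t c))"
    using K2 by (intro mult_right_mono) auto
  finally show ?thesis
    using b(1) assms by (auto simp: treat_inner_def Let_def r weights_within_def)
qed

lemma fold_directions_cost:
  assumes t: "t \<in> nodes T"
    and step: "\<And>c \<sigma>. weights_within k \<sigma> \<Longrightarrow> weights_within k (f c \<sigma>) \<and>
      real (ops (f c \<sigma>)) \<le> real (ops \<sigma>) + K * (real k)\<^sup>2 * real (card (far_field t c))"
    and \<sigma>: "weights_within k \<sigma>"
  shows "weights_within k (fold f (listing (D (level T t))) \<sigma>) \<and>
    real (ops (fold f (listing (D (level T t))) \<sigma>)) \<le> real (ops \<sigma>) + K * (real k)\<^sup>2 * real (card I)"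
proof -
  let ?D = "D (level T t)"
  have fin: "finite ?D" using directions t by (auto simp: direction_family_def)
  have "sum_list (map (\<lambda>c. K * (real k)\<^sup>2 * real (card (far_field t c))) (listing ?D))
      = (\<Sum>c\<in>?D. K * (real k)\<^sup>2 * real (card (far_field t c)))"
    using listing_finite[OF fin] by (simp add: sum_list_distinct_conv_sum_set)
  also have "\<dots> = K * (real k)\<^sup>2 * real (\<Sum>c\<in>?D. card (far_field t c))"
    by (simp add: sum_distrib_left)
  also have "\<dots> \<le> K * (real k)\<^sup>2 * real (card I)"
    using sum_card_far_field[OF fin, of t] K2 Csvd by (intro mult_left_mono of_nat_mono) auto
  finally show ?thesis
    using fold_cost[of "listing ?D" "weights_within k" f ops, OF step \<sigma>] by fastforce
qed

text \<open>
  Every cluster below \<open>t\<close> is treated exactly once, whatever state the recursion starts from, so the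
  cost is proportional to the number of descendants.
\<close>

lemma compress_cost:
  assumes "t \<in> nodes T" "weights_within k \<sigma>"
  shows "weights_within k (compress svd mul k G t \<sigma>) \<and>
    real (ops (compress svd mul k G t \<sigma>))
      \<le> real (ops \<sigma>) + K * (real k)\<^sup>2 * real (card I) * real (card (desc T t))"
  using assms
proof (induction arbitrary: \<sigma> rule: subtree_induct)
  case (leaf t)
  then have "t \<in> leaves T" by (simp add: leaves_def)
  note fold_directions_cost[OF leaf(1) treat_leaf_cost[OF this] leaf(3)]
  moreover have "compress svd mul k G t \<sigma> = fold (treat_leaf svd mul k G t) (listing (D (level T t))) \<sigma>"
    using leaf(1,2) by (subst compress.simps) simp
  moreover have "card (desc T t) = 1" using desc_leaf[OF leaf(1,2)] by simp
  ultimately show ?case by simp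
next
  case (inner t)
  define \<sigma>1 where "\<sigma>1 = compress svd mul k G (son1 t) \<sigma>"
  define \<sigma>2 where "\<sigma>2 = compress svd mul k G (son2 t) \<sigma>1"
  have eq: "compress svd mul k G t \<sigma> = fold (treat_inner svd mul k t) (listing (D (level T t))) \<sigma>2"
    using inner(1,2) unfolding \<sigma>1_def \<sigma>2_def by (subst compress.simps) (simp add: Let_def)
  let ?c = "K * (real k)\<^sup>2 * real (card I)"
  have 1: "weights_within k \<sigma>1"
    "real (ops \<sigma>1) \<le> real (ops \<sigma>) + ?c * real (card (desc T (son1 t)))"
    using inner(3)[OF inner(5)] by (simp_all add: \<sigma>1_def)
  have 2: "weights_within k \<sigma>2"
    "real (ops \<sigma>2) \<le> real (ops \<sigma>1) + ?c * real (card (desc T (son2 t)))"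
    using inner(4)[OF 1(1)] by (simp_all add: \<sigma>2_def)
  have 3: "weights_within k (compress svd mul k G t \<sigma>)"
    "real (ops (compress svd mul k G t \<sigma>)) \<le> real (ops \<sigma>2) + ?c"
    using fold_directions_cost[OF inner(1) treat_inner_cost 2(1)] by (simp_all add: eq)
  have "?c * real (card (desc T t))
      = ?c + ?c * real (card (desc T (son1 t))) + ?c * real (card (desc T (son2 t)))"
    by (simp add: card_desc_inner[OF inner(1,2)] distrib_left)
  then show ?case using 1(2) 2(2) 3 by linarith
qed

lemma compression_ops_bound:
  "real (compression_ops svd mul k G) \<le> K * (real k)\<^sup>2 * real (card (nodes T)) * real (card I)"
proof -
  have "root T \<in> nodes T" using tree by (simp add: rooted_tree_def)
  moreover have "weights_within k (initial_state :: 'n comp_state)"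
    by (simp add: weights_within_def initial_state_def)
  ultimately have "real (compression_ops svd mul k G)
      \<le> real (ops (initial_state :: 'n comp_state))
        + K * (real k)\<^sup>2 * real (card I) * real (card (nodes T))"
    using compress_cost[of "root T" initial_state] by (simp add: compression_ops_def desc_root)
  then show ?thesis by (simp add: initial_state_def mult_ac)
qed

end

end

theorem theorem17:
  fixes I :: "'i set" and T :: "('n, 'i) ctree" and son1 son2 :: "'n \<Rightarrow> 'n"
    and B :: "('n \<times> 'n) rtree" and adm :: "('n \<times> 'n) set"
    and D :: "nat \<Rightarrow> (real ^ 3) set" and sd :: "nat \<Rightarrow> real ^ 3 \<Rightarrow> real ^ 3"
    and bdir :: "'n \<times> 'n \<Rightarrow> real ^ 3"
    and svd :: svd_proc and mul :: mul_proc
    and k :: nat and G :: "'i \<Rightarrow> 'i \<Rightarrow> complex"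
    and C\<^sub>r\<^sub>s C\<^sub>s\<^sub>v\<^sub>d C\<^sub>b\<^sub>b C\<^sub>o\<^sub>v C\<^sub>b\<^sub>a C\<^sub>l\<^sub>v :: real
  assumes "directional_clusters I T son1 son2 B adm D sd bdir"
    and "k \<ge> 1"
    and "C\<^sub>r\<^sub>s > 0" and "C\<^sub>s\<^sub>v\<^sub>d > 0" and "C\<^sub>b\<^sub>b > 0" and "C\<^sub>o\<^sub>v > 0"
    and "\<And>t. t \<in> leaves T \<Longrightarrow>
           inverse C\<^sub>r\<^sub>s * real k \<le> real (card (label T t)) \<and> real (card (label T t)) \<le> C\<^sub>r\<^sub>s * real k"
    and "svd_within C\<^sub>s\<^sub>v\<^sub>d svd"
    and "standard_mul mul"
    and "C\<^sub>b\<^sub>a = max (C\<^sub>s\<^sub>v\<^sub>d * C\<^sub>r\<^sub>s\<^sup>2 + 2 * C\<^sub>r\<^sub>s) (4 * C\<^sub>s\<^sub>v\<^sub>d + 4)"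
    and "C\<^sub>l\<^sub>v = max (C\<^sub>b\<^sub>b * C\<^sub>o\<^sub>v) (2 * C\<^sub>r\<^sub>s)"
  shows "real (directional_clusters.compression_ops T son1 son2 adm D sd bdir svd mul k G)
           \<le> C\<^sub>b\<^sub>a * (real k)\<^sup>2 * real (card (nodes T)) * real (card I) \<and>
         ((\<exists>C\<^sub>s\<^sub>n :: real. C\<^sub>s\<^sub>n \<ge> 1 \<and>
             (\<forall>t \<in> nodes T. real (card (sons T t)) \<le> C\<^sub>s\<^sub>n \<and> card (sons T t) \<noteq> 1)) \<longrightarrow>
          real (directional_clusters.compression_ops T son1 son2 adm D sd bdir svd mul k G)
            \<le> C\<^sub>b\<^sub>a * C\<^sub>l\<^sub>v * real k * (real (card I))\<^sup>2)"
proof (intro conjI impI)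
  interpret directional_clusters I T son1 son2 B adm D sd bdir by fact
  let ?ops = "real (compression_ops svd mul k G)"
  show nodes_bound: "?ops \<le> C\<^sub>b\<^sub>a * (real k)\<^sup>2 * real (card (nodes T)) * real (card I)"
    using assms(7) by (intro compression_ops_bound[OF \<open>C\<^sub>s\<^sub>v\<^sub>d > 0\<close> _ assms(8,9)])
      (auto simp: assms(10))
  have "real k \<le> C\<^sub>r\<^sub>s * real (card (label T t))" if "t \<in> leaves T" for t
    using assms(7)[OF that] \<open>C\<^sub>r\<^sub>s > 0\<close> by (simp add: field_simps)
  moreover have "root T \<in> nodes T" "label T (root T) = I"
    using clusters tree by (auto simp: cluster_tree_def rooted_tree_def)
  ultimately have "(real (card (nodes T)) + 1) * real k \<le> 2 * C\<^sub>r\<^sub>s * real (card I)"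
    using card_desc_bound[of "root T" k C\<^sub>r\<^sub>s] by (simp add: desc_root)
  then have "real (card (nodes T)) * real k \<le> 2 * C\<^sub>r\<^sub>s * real (card I)"
    by (simp add: algebra_simps)
  also have "\<dots> \<le> C\<^sub>l\<^sub>v * real (card I)"
    by (intro mult_right_mono) (auto simp: assms(11))
  finally have card_nodes: "real (card (nodes T)) * real k \<le> C\<^sub>l\<^sub>v * real (card I)" .
  have "0 \<le> C\<^sub>b\<^sub>a" using \<open>C\<^sub>s\<^sub>v\<^sub>d > 0\<close> by (simp add: assms(10) le_max_iff_disj)
  note nodes_bound
  also have "C\<^sub>b\<^sub>a * (real k)\<^sup>2 * real (card (nodes T)) * real (card I)
      = C\<^sub>b\<^sub>a * real k * real (card I) * (real (card (nodes T)) * real k)"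
    by (simp add: power2_eq_square)
  also have "\<dots> \<le> C\<^sub>b\<^sub>a * real k * real (card I) * (C\<^sub>l\<^sub>v * real (card I))"
    using card_nodes \<open>0 \<le> C\<^sub>b\<^sub>a\<close> by (intro mult_left_mono) auto
  also have "\<dots> = C\<^sub>b\<^sub>a * C\<^sub>l\<^sub>v * real k * (real (card I))\<^sup>2"
    by (simp add: power2_eq_square)
  finally show "?ops \<le> C\<^sub>b\<^sub>a * C\<^sub>l\<^sub>v * real k * (real (card I))\<^sup>2" .
qed

end
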